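(* Let $\Omega\subset\mathbb{R}^d$ be open and bounded and let $k:\mathbb{R}^d\times\mathbb{R}^d\to[0,\infty]$ be measurable. Assume: (i) $x\mapsto\int_{\mathbb{R}^d}(1\wedge|x-y|^2)\,k_s(x,y)\,dy$ belongs to $L^1_{loc}(\mathbb{R}^d)$; (ii) there is a constant $A$ with $\displaystyle\sup_{x\in\mathbb{R}^d}\int_{\{y:\,k_s(x,y)\ne0\}}\frac{k_a^2(x,y)}{k_s(x,y)}\,dy\le A$; (iii) for some $\alpha\in(0,2)$, some $\lambda>0$ and all $u\in L^2(\mathbb{R}^d)$: $$\int_{\mathbb{R}^d}\int_{\mathbb{R}^d}(u(x)-u(y))^2k_s(x,y)\,dy\,dx\ \ge\ \lambda\,\alpha(2-\alpha)\int_{\mathbb{R}^d}\int_{\mathbb{R}^d}\frac{(u(x)-u(y))^2}{|x-y|^{d+\alpha}}\,dy\,dx;$$ (iv) there is $D>1$ such that $|k_a(x,y)|\le D^{-1}k_s(x,y)$ for almost every $x,y\in\mathbb{R}^d$. Let $u\in H_\Omega(\mathbb{R}^d;k)$ satisfy $\mathcal{E}^k(u,\varphi)\le0$ for all $\varphi\in H_\Omega(\mathbb{R}^d;k)$. Then $\sup_\Omega u\le0$.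
   Context: Notation: $k_s(x,y)=\frac12(k(x,y)+k(y,x))$ and $k_a(x,y)=\frac12(k(x,y)-k(y,x))$ (with $k_a:=0$ where this expression is undefined). Functions are identified if equal a.e., and $\sup_\Omega u$ is the essential supremum. $H(\mathbb{R}^d;k)=\{v\in L^2(\mathbb{R}^d):(v(x)-v(y))k_s^{1/2}(x,y)\in L^2(\mathbb{R}^d\times\mathbb{R}^d)\}$ with norm $\|v\|^2_{H(\mathbb{R}^d;k)}=\|v\|^2_{L^2(\mathbb{R}^d)}+\int_{\mathbb{R}^d}\int_{\mathbb{R}^d}(v(x)-v(y))^2k_s(x,y)\,dy\,dx$; $H_\Omega(\mathbb{R}^d;k)=\{u\in H(\mathbb{R}^d;k):u=0\text{ a.e. on }\mathbb{R}^d\setminus\Omega\}$. The bilinear form is $\mathcal{E}^k(u,v)=\iint_{\mathbb{R}^d\times\mathbb{R}^d}(u(x)-u(y))v(x)k(x,y)\,dy\,dx$, understood as $$\mathcal{E}^k(u,v)=\tfrac12\iint_{\mathbb{R}^d\times\mathbb{R}^d}(u(x)-u(y))(v(x)-v(y))k_s(x,y)\,dy\,dx+\iint_{\mathbb{R}^d\times\mathbb{R}^d}(u(x)-u(y))v(x)k_a(x,y)\,dy\,dx .$$ *)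

theory Defs
  imports "HOL-Probability.Essential_Supremum"
begin

text \<open>
  Kernels are functions \<open>k :: 'a \<Rightarrow> 'a \<Rightarrow> ennreal\<close> on a Euclidean space \<open>'a\<close> of dimension
  \<open>d = DIM('a)\<close>. Measurability is Lebesgue measurability, and elements of function spaces are
  represented by everywhere defined real functions.
\<close>

definition ksym :: "('a \<Rightarrow> 'a \<Rightarrow> ennreal) \<Rightarrow> 'a \<Rightarrow> 'a \<Rightarrow> ennreal" where
  "ksym k x y = (k x y + k y x) / 2"

text \<open>In \<^typ>\<open>ereal\<close>, \<open>\<infinity> - \<infinity> = \<infinity>\<close>; the only undefined case is therefore set to 0 explicitly.\<close>

definition kanti :: "('a \<Rightarrow> 'a \<Rightarrow> ennreal) \<Rightarrow> 'a \<Rightarrow> 'a \<Rightarrow> ereal" where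
  "kanti k x y =
     (if k x y = \<infinity> \<and> k y x = \<infinity> then 0 else (enn2ereal (k x y) - enn2ereal (k y x)) / 2)"

definition L2 :: "('a::euclidean_space \<Rightarrow> real) set" where
  "L2 = {v. v \<in> borel_measurable lebesgue \<and> integrable lebesgue (\<lambda>x. (v x)\<^sup>2)}"

definition L1_loc :: "('a::euclidean_space \<Rightarrow> ennreal) set" where
  "L1_loc = {f. f \<in> borel_measurable lebesgue \<and>
     (\<forall>K. compact K \<longrightarrow> (\<integral>\<^sup>+x\<in>K. f x \<partial>lebesgue) < \<infinity>)}"

text \<open>
  The second condition says that the extended real valued function
  \<open>(v x - v y) * ksym k x y powr (1/2)\<close> is square integrable on the product space (with
  \<open>0 * \<infinity> = 0\<close>); it is measurable as soon as \<open>k\<close> and \<open>v\<close> are.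
\<close>

definition H :: "('a::euclidean_space \<Rightarrow> 'a \<Rightarrow> ennreal) \<Rightarrow> ('a \<Rightarrow> real) set" where
  "H k = {v \<in> L2. (\<integral>\<^sup>+(x, y). ennreal ((v x - v y)\<^sup>2) * ksym k x y \<partial>lebesgue) < \<infinity>}"

definition H_on :: "'a::euclidean_space set \<Rightarrow> ('a \<Rightarrow> 'a \<Rightarrow> ennreal) \<Rightarrow> ('a \<Rightarrow> real) set" where
  "H_on \<Omega> k = {u \<in> H k. AE x in lebesgue. x \<notin> \<Omega> \<longrightarrow> u x = 0}"

text \<open>
  The conversions of the kernels to real numbers send \<open>\<plusminus>\<infinity>\<close> to 0. This does not affect the form
  when \<open>k\<close> is finite almost everywhere, as it is whenever
  \<open>x \<mapsto> \<integral>(1 \<and> |x - y|\<^sup>2) ksym k x y dy\<close> is locally integrable. If moreover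
  \<open>\<integral>(kanti k x y)\<^sup>2 / ksym k x y dy\<close> is essentially bounded in \<open>x\<close>, both integrals converge
  absolutely for \<open>u\<close> and \<open>v\<close> in \<open>H k\<close>, by the Cauchy-Schwarz inequality.
\<close>

definition energy_form ::
    "('a::euclidean_space \<Rightarrow> 'a \<Rightarrow> ennreal) \<Rightarrow> ('a \<Rightarrow> real) \<Rightarrow> ('a \<Rightarrow> real) \<Rightarrow> real" where
  "energy_form k u v =
     1 / 2 * (LINT (x, y)|lebesgue. (u x - u y) * (v x - v y) * enn2real (ksym k x y)) +
     (LINT (x, y)|lebesgue. (u x - u y) * v x * real_of_ereal (kanti k x y))"

end

theory Submission
  imports Defs
begin

text \<open>
  Write \<open>v\<close> and \<open>w\<close> for the positive parts of \<open>u - l\<close> and \<open>l - u\<close>, where \<open>l \<ge> 0\<close>. The truncation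
  \<open>v\<close> is an admissible test function. Since \<open>v * w = 0\<close>, the increments of \<open>u\<close> split into those of
  \<open>v\<close> and a cross term with a sign: the symmetric and the antisymmetric part of the form together
  give \<open>\<integral>\<integral> v x * w y * k x y\<close>, and \<open>\<bar>k\<^sub>a\<bar> \<le> k\<^sub>s / D\<close> makes this at least \<open>1 - 1/D\<close> times the same
  integral of \<open>k\<^sub>s\<close>. The remaining antisymmetric term \<open>(v x - v y) * v x * k\<^sub>a x y\<close> is a drift, which
  Young's inequality and the bound on \<open>\<integral> k\<^sub>a\<^sup>2 / k\<^sub>s\<close> absorb. This gives
  (lemma \<open>truncation_energy_estimate\<close>)

  \<open>1/4 \<integral>\<integral> (v x - v y)\<^sup>2 * k\<^sub>s x y + (1 - 1/D) \<integral>\<integral> v x * w y * k\<^sub>s x y \<le> A \<integral> v\<^sup>2\<close>.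

  The conclusion follows from using the two terms on the left one after the other
  (lemma \<open>nonpos_of_truncation_estimates\<close>). By the comparison with the fractional seminorm and a
  Faber-Krahn inequality (lemma \<open>faber_krahn_fractional\<close>), the first term is at least
  a large multiple of \<open>\<integral> v\<^sup>2\<close> when \<open>{u > l}\<close> has small measure. Hence \<open>{u > l}\<close> is either null or of
  measure at least some \<open>\<eta> > 0\<close> independent of \<open>l\<close>. As \<open>u\<close> is square integrable, it is therefore
  essentially bounded above, and if \<open>M = sup u > 0\<close>, then letting \<open>l\<close> increase to \<open>M\<close> shows that
  \<open>E = {u \<ge> M}\<close> has positive measure.

  Now let \<open>l\<close> increase to \<open>M\<close> in the second term. There \<open>\<integral> v\<^sup>2\<close> is of order \<open>(M - l)\<^sup>2\<close>, while
  \<open>v \<ge> M - l\<close> on \<open>E\<close>. Dividing by \<open>M - l\<close> leaves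
  \<open>\<integral>\<integral> w y * k\<^sub>s x y\<close> over \<open>x \<in> E\<close> tending to 0. So \<open>k\<^sub>s\<close> vanishes between \<open>E\<close> and its complement: the
  indicator of \<open>E\<close> has no energy, hence no fractional energy. But the Faber-Krahn inequality,
  at a scale \<open>R\<close> that suits the finite measure of \<open>E\<close>, says that a set of positive finite measure
  has positive fractional energy.
\<close>

section \<open>Lebesgue measure on a product\<close>

text \<open>
  Lebesgue measure on a product is the completion of the product of the Borel measures, so
  neither measurability nor Tonelli's theorem for it is an instance of the statements on product
  measures. They are reduced to the Borel case up to null sets. A Borel map stays measurable
  between the completions when preimages of null sets are null.
\<close>

lemma measurable_lebesgue_lebesgueI:
  fixes T :: "'a::euclidean_space \<Rightarrow> 'b::euclidean_space"
  assumes T: "T \<in> borel_measurable borel"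
    and null: "\<And>N. N \<in> null_sets lborel \<Longrightarrow> T -` N \<in> null_sets lborel"
  shows "T \<in> lebesgue \<rightarrow>\<^sub>M lebesgue"
proof (rule completion.measurable_completion2)
  show "T \<in> lebesgue \<rightarrow>\<^sub>M lborel"
    using T by (simp add: measurable_completion)
  show "null_sets lborel \<subseteq> null_sets (distr lebesgue lborel T)"
  proof
    fix N :: "'b set" assume N: "N \<in> null_sets lborel"
    moreover have "N \<in> sets borel" using null_setsD2[OF N] by simp
    ultimately show "N \<in> null_sets (distr lebesgue lborel T)"
      using null[OF N] T by (simp add: null_sets_distr_iff measurable_completion null_sets_completionI)
  qed
qed

lemma measurable_fst_lebesgue:
  "(fst :: 'a::euclidean_space \<times> 'b::euclidean_space \<Rightarrow> 'a) \<in> lebesgue \<rightarrow>\<^sub>M lebesgue"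
proof (rule measurable_lebesgue_lebesgueI)
  fix N :: "'a set" assume "N \<in> null_sets lborel"
  then have "N \<times> UNIV \<in> null_sets (lborel \<Otimes>\<^sub>M (lborel :: 'b measure))"
    by (intro lborel.times_in_null_sets1) auto
  moreover have "fst -` N = N \<times> (UNIV :: 'b set)" by auto
  ultimately show "(fst :: 'a \<times> 'b \<Rightarrow> 'a) -` N \<in> null_sets lborel" by (simp add: lborel_prod)
qed (intro borel_measurable_continuous_onI continuous_intros)

lemma measurable_snd_lebesgue:
  "(snd :: 'a::euclidean_space \<times> 'b::euclidean_space \<Rightarrow> 'b) \<in> lebesgue \<rightarrow>\<^sub>M lebesgue"
proof (rule measurable_lebesgue_lebesgueI)
  fix N :: "'b set" assume "N \<in> null_sets lborel"
  then have "UNIV \<times> N \<in> null_sets ((lborel :: 'a measure) \<Otimes>\<^sub>M lborel)"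
    by (intro lborel.times_in_null_sets2) auto
  moreover have "snd -` N = (UNIV :: 'a set) \<times> N" by auto
  ultimately show "(snd :: 'a \<times> 'b \<Rightarrow> 'b) -` N \<in> null_sets lborel" by (simp add: lborel_prod)
qed (intro borel_measurable_continuous_onI continuous_intros)

lemma distr_swap_lborel:
  "distr (lborel :: ('a::euclidean_space \<times> 'b::euclidean_space) measure) lborel prod.swap = lborel"
proof -
  have "distr (lborel \<Otimes>\<^sub>M lborel) (lborel \<Otimes>\<^sub>M lborel) (\<lambda>(x::'a, y::'b). (y, x)) = lborel \<Otimes>\<^sub>M lborel"
    by (rule lborel_pair.distr_pair_swap[symmetric])
  then show ?thesis
    by (simp add: lborel_prod prod.swap_def[abs_def] case_prod_beta')
qed

lemma measurable_swap_borel: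
  "(prod.swap :: 'a::euclidean_space \<times> 'b::euclidean_space \<Rightarrow> 'b \<times> 'a) \<in> borel_measurable borel"
  by (intro borel_measurable_continuous_onI continuous_intros)

lemma measurable_swap_lebesgue:
  "(prod.swap :: 'a::euclidean_space \<times> 'b::euclidean_space \<Rightarrow> 'b \<times> 'a) \<in> lebesgue \<rightarrow>\<^sub>M lebesgue"
proof (rule measurable_lebesgue_lebesgueI[OF measurable_swap_borel])
  fix N :: "('b \<times> 'a) set" assume "N \<in> null_sets lborel"
  then have "N \<in> null_sets (distr lborel lborel prod.swap)"
    by (simp add: distr_swap_lborel)
  then show "(prod.swap :: 'a \<times> 'b \<Rightarrow> 'b \<times> 'a) -` N \<in> null_sets lborel"
    by (simp add: null_sets_distr_iff measurable_swap_borel)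
qed

lemma distr_swap_lebesgue:
  "distr (lebesgue :: ('a::euclidean_space \<times> 'b::euclidean_space) measure) lebesgue prod.swap = lebesgue"
proof -
  have "distr (lebesgue :: ('a \<times> 'b) measure) lborel prod.swap = lborel"
    by (simp add: distr_completion measurable_swap_borel distr_swap_lborel)
  then show ?thesis
    by (metis completion.completion_distr_eq measurable_swap_borel measurable_completion
        measurable_lborel1 measurable_lborel2)
qed

lemma AE_swap_lebesgue:
  fixes P :: "'a::euclidean_space \<times> 'b::euclidean_space \<Rightarrow> bool"
  assumes "AE z in lebesgue. P z"
  shows "AE z in lebesgue. P (prod.swap z)"
proof (rule AE_distrD[OF measurable_swap_lebesgue])
  show "AE z in distr lebesgue lebesgue prod.swap. P z"
    using assms by (simp only: distr_swap_lebesgue)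
qed

lemma AE_lebesgue_pair:
  fixes P :: "'a::euclidean_space \<times> 'b::euclidean_space \<Rightarrow> bool"
  assumes "AE z in lebesgue. P z"
  shows "AE x in lebesgue. AE y in lebesgue. P (x, y)"
proof -
  have "AE z in lborel \<Otimes>\<^sub>M lborel. P z"
    using assms unfolding lborel_prod by (simp add: AE_completion_iff)
  from lborel_pair.AE_pair[OF this] show ?thesis
    by (simp add: AE_completion_iff)
qed

text \<open>
  The sections of a Lebesgue measurable function are measurable only for almost every \<open>x\<close>, and the
  inner integral agrees with that of a Borel representative only for those \<open>x\<close>. The outer integral
  does not see the difference.
\<close>

lemma nn_integral_lebesgue_pair:
  fixes f :: "'a::euclidean_space \<times> 'b::euclidean_space \<Rightarrow> ennreal"
  assumes "f \<in> borel_measurable lebesgue"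
  shows "(\<integral>\<^sup>+x. \<integral>\<^sup>+y. f (x, y) \<partial>lebesgue \<partial>lebesgue) = (\<integral>\<^sup>+z. f z \<partial>lebesgue)"
proof -
  obtain g where g: "g \<in> borel_measurable lborel" and eq: "AE z in lborel. f z = g z"
    using completion_ex_borel_measurable[OF assms] by auto
  from eq have eq': "AE z in lebesgue. f z = g z" by (rule AE_completion)
  have "(\<integral>\<^sup>+x. \<integral>\<^sup>+y. f (x, y) \<partial>lebesgue \<partial>lebesgue) = (\<integral>\<^sup>+x. \<integral>\<^sup>+y. g (x, y) \<partial>lebesgue \<partial>lebesgue)"
    by (rule nn_integral_cong_AE, rule AE_mp[OF AE_lebesgue_pair[OF eq']])
       (auto intro!: nn_integral_cong_AE)
  also have "\<dots> = (\<integral>\<^sup>+x. \<integral>\<^sup>+y. g (x, y) \<partial>lborel \<partial>lborel)"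
    by (simp add: nn_integral_completion)
  also have "\<dots> = (\<integral>\<^sup>+z. g z \<partial>lborel)"
    using g by (subst lborel.nn_integral_fst) (simp_all add: lborel_prod[symmetric])
  also have "\<dots> = (\<integral>\<^sup>+z. f z \<partial>lebesgue)"
    using nn_integral_cong_AE[OF eq'] by (simp add: nn_integral_completion)
  finally show ?thesis .
qed

text \<open>
  A constant may leave the inner integral only where the section is measurable, which is almost
  everywhere. The exceptional null set does not depend on the constant, so that the constant may
  later depend on \<open>x\<close>.
\<close>

lemma nn_integral_cmult_section:
  fixes f :: "'a::euclidean_space \<times> 'b::euclidean_space \<Rightarrow> ennreal"
  assumes "f \<in> borel_measurable lebesgue"
  shows "AE x in lebesgue. \<forall>c. (\<integral>\<^sup>+y. c * f (x, y) \<partial>lebesgue) = c * (\<integral>\<^sup>+y. f (x, y) \<partial>lebesgue)"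
proof -
  obtain g where g: "g \<in> borel_measurable lborel" and eq: "AE z in lborel. f z = g z"
    using completion_ex_borel_measurable[OF assms] by auto
  from AE_lebesgue_pair[OF AE_completion[OF eq]] show ?thesis
  proof eventually_elim
    case (elim x)
    have "(\<lambda>y. g (x, y)) \<in> borel_measurable lborel"
      using g by (intro measurable_Pair2[of g lborel lborel]) (simp_all add: lborel_prod)
    then have "(\<lambda>y. g (x, y)) \<in> borel_measurable lebesgue"
      by (rule measurable_completion)
    then have "(\<integral>\<^sup>+y. c * g (x, y) \<partial>lebesgue) = c * (\<integral>\<^sup>+y. g (x, y) \<partial>lebesgue)" for c
      by (rule nn_integral_cmult)
    moreover have "(\<integral>\<^sup>+y. c * f (x, y) \<partial>lebesgue) = (\<integral>\<^sup>+y. c * g (x, y) \<partial>lebesgue)" for c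
      using elim by (intro nn_integral_cong_AE) auto
    moreover have "(\<integral>\<^sup>+y. f (x, y) \<partial>lebesgue) = (\<integral>\<^sup>+y. g (x, y) \<partial>lebesgue)"
      using elim by (intro nn_integral_cong_AE) auto
    ultimately show ?case by simp
  qed
qed

lemma integrable_swap_lebesgue:
  fixes f :: "'a::euclidean_space \<times> 'b::euclidean_space \<Rightarrow> real"
  assumes "integrable lebesgue f"
  shows "integrable lebesgue (\<lambda>z. f (prod.swap z))"
  by (rule integrable_distr[OF measurable_swap_lebesgue]) (simp add: distr_swap_lebesgue assms)

lemma integral_swap_lebesgue:
  fixes f :: "'a::euclidean_space \<times> 'b::euclidean_space \<Rightarrow> real"
  assumes "f \<in> borel_measurable lebesgue"
  shows "(LINT z|lebesgue. f (prod.swap z)) = (LINT z|lebesgue. f z)"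
  using integral_distr[OF measurable_swap_lebesgue assms] by (simp add: distr_swap_lebesgue)

section \<open>A Faber-Krahn inequality for the fractional seminorm\<close>

text \<open>
  A point \<open>x\<close> of the support of \<open>v\<close> sees zeros of \<open>v\<close> on at least half of the ball of radius \<open>R\<close>
  around it, because the support is too small to fill the other half. Each of these \<open>y\<close>
  contributes at least \<open>(v x)\<^sup>2 / R powr p\<close> to the inner integral. For \<open>p = d + \<alpha>\<close> the constant is a
  multiple of \<open>R powr - \<alpha>\<close>, which is large for functions of small support.
\<close>

lemma faber_krahn_fractional:
  fixes v :: "'a::euclidean_space \<Rightarrow> real"
  assumes v: "v \<in> borel_measurable lebesgue"
    and R: "R > 0" and p: "p \<ge> 0"
    and small: "emeasure lebesgue {x. v x \<noteq> 0} \<le> ennreal (measure lebesgue (ball (0::'a) R) / 2)"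
  shows "ennreal (measure lebesgue (ball (0::'a) R) / 2 / R powr p) * (\<integral>\<^sup>+x. ennreal ((v x)\<^sup>2) \<partial>lebesgue)
    \<le> (\<integral>\<^sup>+x. \<integral>\<^sup>+y. ennreal ((v x - v y)\<^sup>2 / norm (x - y) powr p) \<partial>lebesgue \<partial>lebesgue)"
proof -
  define b where "b = measure lebesgue (ball (0::'a) R)"
  define F where "F = {x. v x \<noteq> 0}"
  have b0: "b \<ge> 0" by (simp add: b_def)
  have F[measurable]: "F \<in> sets lebesgue"
    using measurable_sets[OF v, of "- {0}"] by (simp add: F_def vimage_def Compl_eq)
  have inner: "ennreal (b / 2 / R powr p * (v x)\<^sup>2)
      \<le> (\<integral>\<^sup>+y. ennreal ((v x - v y)\<^sup>2 / norm (x - y) powr p) \<partial>lebesgue)" for x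
  proof (cases "x \<in> F")
    case False
    then show ?thesis by (simp add: F_def)
  next
    case True
    define G where "G = ball x R - F"
    have G[measurable]: "G \<in> sets lebesgue"
      unfolding G_def by (intro sets.Diff F) simp
    have ball: "emeasure lebesgue (ball x R) = ennreal b"
      using R by (simp add: b_def emeasure_ball content_ball)
    \<comment> \<open>At least half of the ball lies outside the support.\<close>
    have "ennreal b \<le> emeasure lebesgue (G \<union> F)"
      unfolding ball[symmetric] by (intro emeasure_mono) (auto simp: G_def)
    also have "\<dots> \<le> emeasure lebesgue G + emeasure lebesgue F"
      by (intro emeasure_subadditive) auto
    also have "\<dots> \<le> emeasure lebesgue G + ennreal (b / 2)"
      using small by (intro add_left_mono) (simp add: F_def b_def)
    finally have "ennreal b - ennreal (b / 2) \<le> emeasure lebesgue G"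
      by (simp add: ennreal_minus_le_iff add.commute)
    then have le: "ennreal (b / 2) \<le> emeasure lebesgue G"
      using b0 by (simp add: ennreal_minus)
    have "ennreal (b / 2 / R powr p * (v x)\<^sup>2) = ennreal ((v x)\<^sup>2 / R powr p) * ennreal (b / 2)"
      using b0 by (simp add: ennreal_mult'[symmetric] mult.commute)
    also have "\<dots> \<le> ennreal ((v x)\<^sup>2 / R powr p) * emeasure lebesgue G"
      by (intro mult_left_mono le) simp
    also have "\<dots> = (\<integral>\<^sup>+y. ennreal ((v x)\<^sup>2 / R powr p) * indicator G y \<partial>lebesgue)"
      by (simp add: nn_integral_cmult_indicator)
    also have "\<dots> \<le> (\<integral>\<^sup>+y. ennreal ((v x - v y)\<^sup>2 / norm (x - y) powr p) \<partial>lebesgue)"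
    proof (intro nn_integral_mono)
      fix y
      show "ennreal ((v x)\<^sup>2 / R powr p) * indicator G y \<le> ennreal ((v x - v y)\<^sup>2 / norm (x - y) powr p)"
      proof (cases "y \<in> G")
        case True': True
        then have "y \<noteq> x" "v y = 0" "norm (x - y) < R"
          using True by (auto simp: G_def F_def dist_norm)
        then have "(v x)\<^sup>2 / R powr p \<le> (v x - v y)\<^sup>2 / norm (x - y) powr p"
          using R p by (auto intro!: divide_left_mono powr_mono2)
        with True' show ?thesis by (simp add: ennreal_leI)
      qed simp
    qed
    finally show ?thesis .
  qed
  have "ennreal (b / 2 / R powr p) * (\<integral>\<^sup>+x. ennreal ((v x)\<^sup>2) \<partial>lebesgue)
      = (\<integral>\<^sup>+x. ennreal (b / 2 / R powr p) * ennreal ((v x)\<^sup>2) \<partial>lebesgue)"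
    using v by (intro nn_integral_cmult[symmetric]) auto
  also have "\<dots> = (\<integral>\<^sup>+x. ennreal (b / 2 / R powr p * (v x)\<^sup>2) \<partial>lebesgue)"
    using b0 by (intro nn_integral_cong ennreal_mult'[symmetric]) simp
  also have "\<dots> \<le> (\<integral>\<^sup>+x. \<integral>\<^sup>+y. ennreal ((v x - v y)\<^sup>2 / norm (x - y) powr p) \<partial>lebesgue \<partial>lebesgue)"
    by (intro nn_integral_mono inner)
  finally show ?thesis by (simp add: b_def)
qed

section \<open>Energy of truncations\<close>

text \<open>
  Young's inequality with weight \<open>s\<close>. The factor \<open>1/4\<close> leaves half of the symmetric part
  \<open>1/2 * p\<^sup>2 * s\<close> of the energy when the drift is absorbed. The second hypothesis makes the value
  \<open>0 / 0 = 0\<close> correct where the kernel vanishes.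
\<close>

lemma kernel_young:
  fixes s a p q :: real
  assumes "0 \<le> s" "s = 0 \<Longrightarrow> a = 0"
  shows "\<bar>p * q * a\<bar> \<le> p\<^sup>2 * s / 4 + q\<^sup>2 * (a\<^sup>2 / s)"
proof (cases "s = 0")
  case False
  then have s: "s > 0" using assms by simp
  have "0 \<le> (\<bar>p\<bar> * s / 2 - \<bar>q\<bar> * \<bar>a\<bar>)\<^sup>2" by simp
  then have "\<bar>p\<bar> * \<bar>q\<bar> * \<bar>a\<bar> * s \<le> p\<^sup>2 * s\<^sup>2 / 4 + q\<^sup>2 * a\<^sup>2"
    by (simp add: power2_diff power_mult_distrib power_divide algebra_simps)
  then show ?thesis
    using s by (simp add: abs_mult field_simps power2_eq_square)
qed (use assms in simp)

text \<open>
  Caccioppoli-type estimate from testing with the truncation \<open>v l\<close>. Here \<open>s\<close> and \<open>a\<close> stand for real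
  valued versions of the symmetric and antisymmetric kernel. The second term on the left records
  the interaction between \<open>{u > l}\<close> and \<open>{u < l}\<close>, which has a sign when \<open>\<theta> \<le> 1\<close> and is
  kept for the analysis of the set where \<open>u\<close> attains its supremum.
\<close>

lemma truncation_energy_estimate:
  fixes s a :: "'a::euclidean_space \<times> 'a \<Rightarrow> real" and u :: "'a \<Rightarrow> real"
  defines "v \<equiv> \<lambda>l x. max 0 (u x - l)" and "w \<equiv> \<lambda>l x. max 0 (l - u x)"
  assumes u: "u \<in> borel_measurable lebesgue" and u2: "integrable lebesgue (\<lambda>x. (u x)\<^sup>2)"
    and s: "s \<in> borel_measurable lebesgue" and a: "a \<in> borel_measurable lebesgue"
    and s0: "\<And>z. 0 \<le> s z" and sym: "\<And>z. s (prod.swap z) = s z"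
    and fin: "integrable lebesgue (\<lambda>z. (u (fst z) - u (snd z))\<^sup>2 * s z)"
    and dom: "AE z in lebesgue. \<bar>a z\<bar> \<le> \<theta> * s z"
    and A: "0 \<le> A"
    and drift: "AE x in lebesgue. (\<integral>\<^sup>+y. ennreal ((a (x, y))\<^sup>2 / s (x, y)) \<partial>lebesgue) \<le> ennreal A"
    and l: "0 \<le> l"
    and test: "1 / 2 * (LINT z|lebesgue. (u (fst z) - u (snd z)) * (v l (fst z) - v l (snd z)) * s z)
        + (LINT z|lebesgue. (u (fst z) - u (snd z)) * v l (fst z) * a z) \<le> 0"
  shows "integrable lebesgue (\<lambda>z. (v l (fst z) - v l (snd z))\<^sup>2 * s z)"
    and "integrable lebesgue (\<lambda>z. v l (fst z) * w l (snd z) * s z)"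
    and "1 / 4 * (LINT z|lebesgue. (v l (fst z) - v l (snd z))\<^sup>2 * s z)
        + (1 - \<theta>) * (LINT z|lebesgue. v l (fst z) * w l (snd z) * s z)
        \<le> A * (LINT x|lebesgue. (v l x)\<^sup>2)"
proof -
  define f g where "f = v l" and "g = w l"
  define U where "U z = u (fst z) - u (snd z)" for z :: "'a \<times> 'a"
  define V where "V z = f (fst z) - f (snd z)" for z :: "'a \<times> 'a"
  define W where "W z = f (fst z) * g (snd z)" for z :: "'a \<times> 'a"
  have [measurable]: "f \<in> borel_measurable lebesgue" "g \<in> borel_measurable lebesgue"
    using u by (auto simp: f_def g_def v_def w_def)
  note [measurable] = u s a
  have [measurable]: "(\<lambda>z. u (fst z)) \<in> borel_measurable (lebesgue :: ('a \<times> 'a) measure)"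
    "(\<lambda>z. u (snd z)) \<in> borel_measurable (lebesgue :: ('a \<times> 'a) measure)"
    "(\<lambda>z. f (fst z)) \<in> borel_measurable (lebesgue :: ('a \<times> 'a) measure)"
    "(\<lambda>z. f (snd z)) \<in> borel_measurable (lebesgue :: ('a \<times> 'a) measure)"
    "(\<lambda>z. g (snd z)) \<in> borel_measurable (lebesgue :: ('a \<times> 'a) measure)"
    by (auto intro: measurable_compose[OF measurable_fst_lebesgue] measurable_compose[OF measurable_snd_lebesgue]
        simp: u)
  have [measurable]: "U \<in> borel_measurable lebesgue" "V \<in> borel_measurable lebesgue" "W \<in> borel_measurable lebesgue"
    by (auto simp: U_def[abs_def] V_def[abs_def] W_def[abs_def])
  have f0: "0 \<le> f x" and g0: "0 \<le> g x" for x by (auto simp: f_def g_def v_def w_def)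
  have W0: "0 \<le> W z" for z using f0 g0 by (simp add: W_def)
  have VU: "\<bar>V z\<bar> \<le> \<bar>U z\<bar>" for z
    by (auto simp: V_def U_def f_def v_def max_def)
  \<comment> \<open>The two pointwise identities behind the proof: both use that \<open>f * g = 0\<close>.\<close>
  have split: "U z * V z = (V z)\<^sup>2 + (W z + W (prod.swap z))" for z
    by (auto simp: V_def U_def W_def f_def v_def g_def w_def max_def power2_eq_square algebra_simps)
  have split': "U z * f (fst z) = V z * f (fst z) + W z" for z
    by (auto simp: V_def U_def W_def f_def v_def g_def w_def max_def algebra_simps)
  have fu: "(f x)\<^sup>2 \<le> (u x)\<^sup>2" for x
    using l by (auto simp: f_def v_def max_def intro!: power_mono)
  have f2: "integrable lebesgue (\<lambda>x. (f x)\<^sup>2)"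
    by (rule Bochner_Integration.integrable_bound[OF u2]) (auto simp: fu)
  have U2: "integrable lebesgue (\<lambda>z. (U z)\<^sup>2 * s z)"
    using fin by (simp add: U_def)
  have V2: "integrable lebesgue (\<lambda>z. (V z)\<^sup>2 * s z)"
  proof (rule Bochner_Integration.integrable_bound[OF U2])
    show "AE z in lebesgue. norm ((V z)\<^sup>2 * s z) \<le> norm ((U z)\<^sup>2 * s z)"
      using VU s0 by (auto simp: abs_mult intro!: mult_right_mono simp flip: abs_le_square_iff)
  qed auto
  have Wint: "integrable lebesgue (\<lambda>z. W z * s z)"
  proof (rule Bochner_Integration.integrable_bound[OF U2])
    have "W z \<le> (U z)\<^sup>2" for z
    proof -
      have "W z \<le> U z * V z" using split[of z] W0[of "prod.swap z"] by simp
      also have "\<dots> \<le> \<bar>U z\<bar> * \<bar>V z\<bar>" by (metis abs_ge_self abs_mult)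
      also have "\<dots> \<le> \<bar>U z\<bar> * \<bar>U z\<bar>" by (intro mult_left_mono VU) simp
      finally show ?thesis by (simp add: power2_eq_square)
    qed
    then show "AE z in lebesgue. norm (W z * s z) \<le> norm ((U z)\<^sup>2 * s z)"
      using W0 s0 by (auto simp: abs_mult intro!: mult_right_mono)
  qed auto
  have Wint': "integrable lebesgue (\<lambda>z. W (prod.swap z) * s z)"
    using integrable_swap_lebesgue[OF Wint] by (simp add: sym)
  have Wswap: "(LINT z|lebesgue. W (prod.swap z) * s z) = (LINT z|lebesgue. W z * s z)"
    using integral_swap_lebesgue[of "\<lambda>z. W z * s z"] by (simp add: sym)
  \<comment> \<open>The drift costs no more than \<open>A\<close> times the square norm: integrate over \<open>y\<close> first.\<close>
  have drift_le: "(\<integral>\<^sup>+z. ennreal ((f (fst z))\<^sup>2 * ((a z)\<^sup>2 / s z)) \<partial>lebesgue)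
      \<le> ennreal (A * (LINT x|lebesgue. (f x)\<^sup>2))"
  proof -
    have "(\<integral>\<^sup>+z. ennreal ((f (fst z))\<^sup>2 * ((a z)\<^sup>2 / s z)) \<partial>lebesgue)
        = (\<integral>\<^sup>+x. \<integral>\<^sup>+y. ennreal ((f x)\<^sup>2 * ((a (x, y))\<^sup>2 / s (x, y))) \<partial>lebesgue \<partial>lebesgue)"
      by (subst nn_integral_lebesgue_pair[symmetric]) auto
    also have "\<dots> \<le> (\<integral>\<^sup>+x. ennreal A * ennreal ((f x)\<^sup>2) \<partial>lebesgue)"
    proof (rule nn_integral_mono_AE)
      have "AE x in lebesgue. \<forall>c. (\<integral>\<^sup>+y. c * ennreal ((a (x, y))\<^sup>2 / s (x, y)) \<partial>lebesgue)
          = c * (\<integral>\<^sup>+y. ennreal ((a (x, y))\<^sup>2 / s (x, y)) \<partial>lebesgue)"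
        by (rule nn_integral_cmult_section) measurable
      with drift show "AE x in lebesgue. (\<integral>\<^sup>+y. ennreal ((f x)\<^sup>2 * ((a (x, y))\<^sup>2 / s (x, y))) \<partial>lebesgue)
          \<le> ennreal A * ennreal ((f x)\<^sup>2)"
      proof eventually_elim
        case (elim x)
        have "(\<integral>\<^sup>+y. ennreal ((f x)\<^sup>2 * ((a (x, y))\<^sup>2 / s (x, y))) \<partial>lebesgue)
            = ennreal ((f x)\<^sup>2) * (\<integral>\<^sup>+y. ennreal ((a (x, y))\<^sup>2 / s (x, y)) \<partial>lebesgue)"
          using elim(2)[rule_format, of "ennreal ((f x)\<^sup>2)"] by (simp only: ennreal_mult'[OF zero_le_power2])
        also have "\<dots> \<le> ennreal ((f x)\<^sup>2) * ennreal A"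
          by (intro mult_left_mono elim(1)) simp
        finally show ?case by (simp add: mult.commute)
      qed
    qed
    also have "\<dots> = ennreal A * ennreal (LINT x|lebesgue. (f x)\<^sup>2)"
      using f2 by (simp add: nn_integral_cmult nn_integral_eq_integral)
    finally show ?thesis using A by (simp add: ennreal_mult')
  qed
  have Z: "integrable lebesgue (\<lambda>z. (f (fst z))\<^sup>2 * ((a z)\<^sup>2 / s z))"
    using drift_le s0 by (intro integrableI_nonneg) (auto intro: le_less_trans)
  have Zle: "(LINT z|lebesgue. (f (fst z))\<^sup>2 * ((a z)\<^sup>2 / s z)) \<le> A * (LINT x|lebesgue. (f x)\<^sup>2)"
    using drift_le A s0 by (subst (asm) nn_integral_eq_integral[OF Z]) (auto simp: ennreal_le_iff)
  have young: "AE z in lebesgue. \<bar>p z * f (fst z) * a z\<bar> \<le> (p z)\<^sup>2 * s z / 4 + (f (fst z))\<^sup>2 * ((a z)\<^sup>2 / s z)" for p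
    using dom by eventually_elim (rule kernel_young, auto simp: s0)
  have Ua: "integrable lebesgue (\<lambda>z. U z * f (fst z) * a z)"
  proof (rule Bochner_Integration.integrable_bound[OF Bochner_Integration.integrable_add[OF integrable_divide_zero[OF U2, of 4] Z]])
    show "AE z in lebesgue. norm (U z * f (fst z) * a z) \<le> norm ((U z)\<^sup>2 * s z / 4 + (f (fst z))\<^sup>2 * ((a z)\<^sup>2 / s z))"
      using young[of U] by eventually_elim auto
  qed auto
  have Va: "integrable lebesgue (\<lambda>z. V z * f (fst z) * a z)"
  proof (rule Bochner_Integration.integrable_bound[OF Bochner_Integration.integrable_add[OF integrable_divide_zero[OF V2, of 4] Z]])
    show "AE z in lebesgue. norm (V z * f (fst z) * a z) \<le> norm ((V z)\<^sup>2 * s z / 4 + (f (fst z))\<^sup>2 * ((a z)\<^sup>2 / s z))"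
      using young[of V] by eventually_elim auto
  qed auto
  have Wa: "integrable lebesgue (\<lambda>z. W z * a z)"
    using Bochner_Integration.integrable_diff[OF Ua Va] by (simp add: split' algebra_simps)
  \<comment> \<open>Exchanging the variables turns the two symmetric cross terms into twice the same integral.\<close>
  have I1: "(LINT z|lebesgue. U z * V z * s z)
      = (LINT z|lebesgue. (V z)\<^sup>2 * s z) + 2 * (LINT z|lebesgue. W z * s z)"
    using V2 Wint Wint' Wswap by (simp add: split distrib_right)
  have I2: "(LINT z|lebesgue. U z * f (fst z) * a z)
      = (LINT z|lebesgue. V z * f (fst z) * a z) + (LINT z|lebesgue. W z * a z)"
    using Va Wa by (simp add: split' distrib_right)
  have "- (1 / 4 * (LINT z|lebesgue. (V z)\<^sup>2 * s z) + (LINT z|lebesgue. (f (fst z))\<^sup>2 * ((a z)\<^sup>2 / s z)))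
      = (LINT z|lebesgue. - ((V z)\<^sup>2 * s z / 4 + (f (fst z))\<^sup>2 * ((a z)\<^sup>2 / s z)))"
    using V2 Z by simp
  also have "\<dots> \<le> (LINT z|lebesgue. V z * f (fst z) * a z)"
    using V2 Z Va young[of V] by (intro integral_mono_AE) auto
  finally have J1: "- (1 / 4 * (LINT z|lebesgue. (V z)\<^sup>2 * s z) + (LINT z|lebesgue. (f (fst z))\<^sup>2 * ((a z)\<^sup>2 / s z)))
      \<le> (LINT z|lebesgue. V z * f (fst z) * a z)" .
  \<comment> \<open>The antisymmetric cross term may be negative, but not by more than \<open>\<theta>\<close> times the symmetric one.\<close>
  have "- \<theta> * (LINT z|lebesgue. W z * s z) = (LINT z|lebesgue. - \<theta> * (W z * s z))"
    by simp
  also have "\<dots> \<le> (LINT z|lebesgue. W z * a z)"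
  proof (rule integral_mono_AE)
    show "AE z in lebesgue. - \<theta> * (W z * s z) \<le> W z * a z"
      using dom
    proof eventually_elim
      case (elim z)
      then have "W z * (- (\<theta> * s z)) \<le> W z * a z"
        by (intro mult_left_mono W0) auto
      then show ?case by (simp add: mult_ac)
    qed
  qed (use Wint Wa in auto)
  finally have J2: "- \<theta> * (LINT z|lebesgue. W z * s z) \<le> (LINT z|lebesgue. W z * a z)" .
  have "1 / 2 * (LINT z|lebesgue. U z * V z * s z) + (LINT z|lebesgue. U z * f (fst z) * a z) \<le> 0"
    using test by (simp add: U_def V_def f_def)
  with I1 I2 J1 J2 Zle
  have "1 / 4 * (LINT z|lebesgue. (V z)\<^sup>2 * s z) + (1 - \<theta>) * (LINT z|lebesgue. W z * s z)
      \<le> A * (LINT x|lebesgue. (f x)\<^sup>2)"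
    by (simp add: algebra_simps)
  then show "1 / 4 * (LINT z|lebesgue. (v l (fst z) - v l (snd z))\<^sup>2 * s z)
        + (1 - \<theta>) * (LINT z|lebesgue. v l (fst z) * w l (snd z) * s z)
        \<le> A * (LINT x|lebesgue. (v l x)\<^sup>2)"
    by (simp add: V_def W_def f_def g_def)
  show "integrable lebesgue (\<lambda>z. (v l (fst z) - v l (snd z))\<^sup>2 * s z)"
    using V2 by (simp add: V_def f_def)
  show "integrable lebesgue (\<lambda>z. v l (fst z) * w l (snd z) * s z)"
    using Wint by (simp add: W_def f_def g_def)
qed

section \<open>From truncations to the essential supremum\<close>

lemma AE_zero_of_L2_norm_le:
  fixes f :: "'a::euclidean_space \<Rightarrow> real"
  assumes f: "integrable lebesgue (\<lambda>x. (f x)\<^sup>2)"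
    and le: "ennreal a * (\<integral>\<^sup>+x. ennreal ((f x)\<^sup>2) \<partial>lebesgue) \<le> ennreal (b * (LINT x|lebesgue. (f x)\<^sup>2))"
    and ab: "0 \<le> b" "b < a"
  shows "AE x in lebesgue. f x = 0"
proof -
  define I where "I = (LINT x|lebesgue. (f x)\<^sup>2)"
  have I0: "I \<ge> 0" by (simp add: I_def)
  have "ennreal (a * I) \<le> ennreal (b * I)"
    using le ab f I0 by (simp add: nn_integral_eq_integral I_def ennreal_mult')
  then have "a * I \<le> b * I" using I0 ab by (simp add: ennreal_le_iff)
  then have "I = 0" using I0 ab mult_right_less_imp_less[of b I a] by (cases "I = 0") (auto simp: mult_le_cancel_right)
  then show ?thesis
    using integral_nonneg_eq_0_iff_AE[OF f] by (simp add: I_def)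
qed

lemma chebyshev_L2:
  fixes u :: "'a::euclidean_space \<Rightarrow> real"
  assumes u: "u \<in> borel_measurable lebesgue" and u2: "integrable lebesgue (\<lambda>x. (u x)\<^sup>2)" and l: "0 < l"
  shows "emeasure lebesgue {x. l \<le> u x} \<le> ennreal ((LINT x|lebesgue. (u x)\<^sup>2) / l\<^sup>2)"
proof -
  have [measurable]: "{x. l \<le> u x} \<in> sets lebesgue"
    using measurable_sets[OF u, of "{l..}"] by (simp add: vimage_def atLeast_def)
  have "emeasure lebesgue {x. l \<le> u x} = (\<integral>\<^sup>+x. indicator {x. l \<le> u x} x \<partial>lebesgue)"
    by simp
  also have "\<dots> \<le> (\<integral>\<^sup>+x. ennreal ((u x)\<^sup>2 / l\<^sup>2) \<partial>lebesgue)"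
  proof (rule nn_integral_mono)
    fix x
    show "indicator {x. l \<le> u x} x \<le> ennreal ((u x)\<^sup>2 / l\<^sup>2)"
      using l by (auto simp: indicator_def intro!: power_mono)
  qed
  also have "\<dots> = ennreal ((LINT x|lebesgue. (u x)\<^sup>2) / l\<^sup>2)"
    using u2 by (subst nn_integral_eq_integral) auto
  finally show ?thesis .
qed

text \<open>
  The estimates for all truncations, together with coercivity, exclude a positive essential supremum \<open>M\<close>. Small superlevel sets are null by
  coercivity, so that \<open>M\<close> is finite and attained on a set \<open>E\<close> of positive measure. The cross terms for
  \<open>l\<close> tending to \<open>M\<close> then disconnect \<open>E\<close> from its complement, which coercivity forbids.
\<close>

lemma nonpos_of_truncation_estimates:
  fixes u :: "'a::euclidean_space \<Rightarrow> real" and s :: "'a \<times> 'a \<Rightarrow> real"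
  defines "v \<equiv> \<lambda>l x. max 0 (u x - l)" and "w \<equiv> \<lambda>l x. max 0 (l - u x)"
  assumes u: "u \<in> borel_measurable lebesgue" and u2: "integrable lebesgue (\<lambda>x. (u x)\<^sup>2)"
    and s: "s \<in> borel_measurable lebesgue"
    and s0: "\<And>z. 0 \<le> s z" and sym: "\<And>z. s (prod.swap z) = s z"
    and A: "0 \<le> A" and \<theta>: "\<theta> < 1" and c: "0 < c" and \<alpha>: "0 < \<alpha>"
    and V: "\<And>l. 0 \<le> l \<Longrightarrow> integrable lebesgue (\<lambda>z. (v l (fst z) - v l (snd z))\<^sup>2 * s z)"
    and W: "\<And>l. 0 \<le> l \<Longrightarrow> integrable lebesgue (\<lambda>z. v l (fst z) * w l (snd z) * s z)"
    and est: "\<And>l. 0 \<le> l \<Longrightarrow> 1 / 4 * (LINT z|lebesgue. (v l (fst z) - v l (snd z))\<^sup>2 * s z)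
        + (1 - \<theta>) * (LINT z|lebesgue. v l (fst z) * w l (snd z) * s z)
        \<le> A * (LINT x|lebesgue. (v l x)\<^sup>2)"
    and coer: "\<And>e. e \<in> L2 \<Longrightarrow> ennreal c *
        (\<integral>\<^sup>+x. \<integral>\<^sup>+y. ennreal ((e x - e y)\<^sup>2 / norm (x - y) powr (real DIM('a) + \<alpha>)) \<partial>lebesgue \<partial>lebesgue)
        \<le> (\<integral>\<^sup>+z. ennreal ((e (fst z) - e (snd z))\<^sup>2 * s z) \<partial>lebesgue)"
  shows "AE x in lebesgue. u x \<le> 0"
proof -
  note [measurable] = u s
  have lev[measurable]: "{x. l \<le> u x} \<in> sets lebesgue" "{x. l < u x} \<in> sets lebesgue" for l
    using measurable_sets[OF u, of "{l..}"] measurable_sets[OF u, of "{l<..}"]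
    by (simp_all add: vimage_def atLeast_def greaterThan_def)
  define \<beta> where "\<beta> = measure lebesgue (ball (0::'a) 1)"
  have \<beta>: "\<beta> > 0" by (simp add: \<beta>_def content_ball_pos)
  have ball: "measure lebesgue (ball (0::'a) R) = \<beta> * R ^ DIM('a)" if "R > 0" for R
    using content_ball_conv_unit_ball[of R "0::'a"] that by (simp add: \<beta>_def mult.commute)
  have v2: "integrable lebesgue (\<lambda>x. (v l x)\<^sup>2)" if "0 \<le> l" for l
  proof (rule Bochner_Integration.integrable_bound[OF u2])
    show "AE x in lebesgue. norm ((v l x)\<^sup>2) \<le> norm ((u x)\<^sup>2)"
      using that by (auto simp: v_def max_def intro!: power_mono)
  qed (simp add: v_def)
  have gap: "ennreal (c * (\<beta> / 2 / R powr \<alpha>)) * (\<integral>\<^sup>+x. ennreal ((e x)\<^sup>2) \<partial>lebesgue)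
      \<le> (\<integral>\<^sup>+z. ennreal ((e (fst z) - e (snd z))\<^sup>2 * s z) \<partial>lebesgue)"
    if e: "e \<in> L2" and R: "R > 0" and small: "emeasure lebesgue {x. e x \<noteq> 0} \<le> ennreal (\<beta> * R ^ DIM('a) / 2)" for e R
  proof -
    have "\<beta> * R ^ DIM('a) / 2 / R powr (real DIM('a) + \<alpha>) = \<beta> / 2 / R powr \<alpha>"
      using R by (simp add: powr_add powr_realpow)
    then have "ennreal (\<beta> / 2 / R powr \<alpha>) * (\<integral>\<^sup>+x. ennreal ((e x)\<^sup>2) \<partial>lebesgue)
      \<le> (\<integral>\<^sup>+x. \<integral>\<^sup>+y. ennreal ((e x - e y)\<^sup>2 / norm (x - y) powr (real DIM('a) + \<alpha>)) \<partial>lebesgue \<partial>lebesgue)"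
      using faber_krahn_fractional[of e R "real DIM('a) + \<alpha>"] e R small \<alpha>
      unfolding ball[OF R] by (simp add: L2_def)
    then have "ennreal c * (ennreal (\<beta> / 2 / R powr \<alpha>) * (\<integral>\<^sup>+x. ennreal ((e x)\<^sup>2) \<partial>lebesgue))
      \<le> (\<integral>\<^sup>+z. ennreal ((e (fst z) - e (snd z))\<^sup>2 * s z) \<partial>lebesgue)"
      by (intro order.trans[OF mult_left_mono coer] e) auto
    moreover have "ennreal (c * (\<beta> / 2 / R powr \<alpha>)) = ennreal c * ennreal (\<beta> / 2 / R powr \<alpha>)"
      using c \<beta> by (intro ennreal_mult) auto
    ultimately show ?thesis by (simp add: mult.assoc)
  qed
  \<comment> \<open>This radius makes the constant in the spectral gap \<open>4 * A + 1\<close>, which exceeds the constant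
    \<open>4 * A\<close> that the truncation estimate allows.\<close>
  define R where "R = (c * \<beta> / (2 * (4 * A + 1))) powr (1 / \<alpha>)"
  define \<eta> where "\<eta> = \<beta> * R ^ DIM('a) / 2"
  have R: "R > 0" using c \<beta> A by (simp add: R_def)
  have \<eta>: "\<eta> > 0" using \<beta> R by (simp add: \<eta>_def)
  have R\<alpha>: "c * (\<beta> / 2 / R powr \<alpha>) = 4 * A + 1"
    using c \<beta> A \<alpha> by (simp add: R_def powr_powr field_simps)
  have large: "\<not> (AE x in lebesgue. u x \<le> l) \<Longrightarrow> ennreal \<eta> < emeasure lebesgue {x. l < u x}" if l: "0 \<le> l" for l
  proof (rule ccontr)
    assume n: "\<not> (AE x in lebesgue. u x \<le> l)" and "\<not> ennreal \<eta> < emeasure lebesgue {x. l < u x}"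
    moreover have "{x. v l x \<noteq> 0} = {x. l < u x}" by (auto simp: v_def max_def)
    ultimately have small: "emeasure lebesgue {x. v l x \<noteq> 0} \<le> ennreal \<eta>"
      by (simp add: not_less)
    have "v l \<in> L2" using v2[OF l] by (simp add: L2_def v_def)
    from gap[OF this R small[unfolded \<eta>_def]]
    have "ennreal (4 * A + 1) * (\<integral>\<^sup>+x. ennreal ((v l x)\<^sup>2) \<partial>lebesgue)
        \<le> (\<integral>\<^sup>+z. ennreal ((v l (fst z) - v l (snd z))\<^sup>2 * s z) \<partial>lebesgue)"
      by (simp only: R\<alpha>)
    also have "\<dots> = ennreal (LINT z|lebesgue. (v l (fst z) - v l (snd z))\<^sup>2 * s z)"
      using V[OF l] s0 by (intro nn_integral_eq_integral) auto
    also have "\<dots> \<le> ennreal (4 * A * (LINT x|lebesgue. (v l x)\<^sup>2))"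
    proof (rule ennreal_leI)
      have "0 \<le> (1 - \<theta>) * (LINT z|lebesgue. v l (fst z) * w l (snd z) * s z)"
        using \<theta> s0 by (intro mult_nonneg_nonneg Bochner_Integration.integral_nonneg) (auto simp: v_def w_def)
      with est[OF l] show "(LINT z|lebesgue. (v l (fst z) - v l (snd z))\<^sup>2 * s z) \<le> 4 * A * (LINT x|lebesgue. (v l x)\<^sup>2)"
        by simp
    qed
    finally have "AE x in lebesgue. v l x = 0"
      by (rule AE_zero_of_L2_norm_le[OF v2[OF l]]) (use A in auto)
    then have "AE x in lebesgue. u x \<le> l"
      by eventually_elim (auto simp: v_def max_def split: if_splits)
    with n show False by simp
  qed
  define J where "J = (LINT x|lebesgue. (u x)\<^sup>2)"
  have J0: "J \<ge> 0" by (simp add: J_def)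
  have fin: "emeasure lebesgue {x. l \<le> u x} \<le> ennreal (J / l\<^sup>2)" if "0 < l" for l
    using chebyshev_L2[OF u u2 that] by (simp add: J_def)
  define S where "S = {l. 0 \<le> l \<and> (AE x in lebesgue. u x \<le> l)}"
  define M where "M = Inf S"
  have S_ne: "S \<noteq> {}"
  proof -
    define l where "l = sqrt (J / \<eta>) + 1"
    have l: "l > 0" using J0 \<eta> by (simp add: l_def add_nonneg_pos)
    have "J / \<eta> \<le> l\<^sup>2"
      using J0 \<eta> by (simp add: l_def power2_sum)
    then have "J / l\<^sup>2 \<le> \<eta>" using \<eta> l by (simp add: field_simps)
    then have "emeasure lebesgue {x. l < u x} \<le> ennreal \<eta>"
      by (intro order.trans[OF emeasure_mono order.trans[OF fin[OF l] ennreal_leI]]) (auto intro: lev)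
    then have "l \<in> S" using large[of l] l by (auto simp: S_def not_less[symmetric])
    then show ?thesis by auto
  qed
  have bdd: "bdd_below S" by (auto simp: S_def bdd_below_def)
  have M0: "M \<ge> 0" unfolding M_def using S_ne by (intro cInf_greatest) (auto simp: S_def)
  have below: "ennreal \<eta> < emeasure lebesgue {x. l < u x}" if "0 \<le> l" "l < M" for l
  proof (rule large[OF that(1)])
    have "l \<notin> S" using cInf_lower[OF _ bdd, of l] that(2) by (auto simp: M_def)
    with that(1) show "\<not> (AE x in lebesgue. u x \<le> l)" by (simp add: S_def)
  qed
  have uM: "AE x in lebesgue. u x \<le> M"
  proof -
    have "AE x in lebesgue. u x \<le> M + 1 / Suc n" for n
    proof -
      have "Inf S < M + 1 / Suc n" by (simp add: M_def)
      then obtain l where "l \<in> S" "l < M + 1 / Suc n"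
        using cInf_lessD[OF S_ne] by blast
      then show ?thesis by (auto simp: S_def elim!: eventually_mono)
    qed
    then have "AE x in lebesgue. \<forall>n. u x \<le> M + 1 / Suc n" by (simp add: AE_all_countable)
    then show ?thesis
    proof eventually_elim
      case (elim x)
      show ?case
      proof (rule field_le_epsilon)
        fix e :: real assume "0 < e"
        then obtain n where "inverse (real (Suc n)) < e" using reals_Archimedean by blast
        with elim[rule_format, of n] show "u x \<le> M + e" by (simp add: inverse_eq_divide)
      qed
    qed
  qed
  show ?thesis
  proof (cases "M = 0")
    case True
    with uM show ?thesis by simp
  next
    case False
    with M0 have M: "M > 0" by simp
    define E where "E = {x. M \<le> u x}"
    \<comment> \<open>Levels that increase to \<open>M\<close>, from \<open>M / 2\<close> on: this keeps \<open>v\<close> below a multiple of \<open>u\<close>.\<close>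
    define t where "t n = M * (1 - 1 / real (Suc (Suc n)))" for n
    have t: "0 < t n" "t n < M" for n
    proof -
      have "0 < 1 / real (Suc (Suc n))" "1 / real (Suc (Suc n)) < 1" by auto
      then have "0 < 1 - 1 / real (Suc (Suc n))" "1 - 1 / real (Suc (Suc n)) < 1" by linarith+
      then show "0 < t n" "t n < M"
        using mult_strict_left_mono[OF _ M] by (fastforce simp only: t_def mult_zero_right mult_1_right)+
    qed
    have t_incr: "t m \<le> t n" if "m \<le> n" for m n
      using M that by (auto simp: t_def frac_le)
    have t_half: "M / 2 \<le> t n" for n
      using t_incr[of 0 n] by (simp add: t_def)
    have "(\<lambda>n. 1 / real (Suc (Suc n))) \<longlonglongrightarrow> 0"
      using LIMSEQ_Suc[OF LIMSEQ_inverse_real_of_nat] by (simp add: inverse_eq_divide)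
    then have "t \<longlonglongrightarrow> M * (1 - 0)"
      unfolding t_def by (intro tendsto_intros)
    then have t_lim: "t \<longlonglongrightarrow> M" by simp
    have E[measurable]: "E \<in> sets lebesgue"
      unfolding E_def by (rule lev)
    have E_fin: "emeasure lebesgue E \<le> ennreal (J / M\<^sup>2)"
      using fin[OF M] by (simp add: E_def)
    have E_pos: "ennreal \<eta> \<le> emeasure lebesgue E"
    proof (rule LIMSEQ_le_const)
      have "(\<Inter>n. {x. t n < u x}) = E"
      proof safe
        fix x assume "x \<in> (\<Inter>n. {x. t n < u x})"
        then have "t n \<le> u x" for n by (auto intro: less_imp_le)
        then show "x \<in> E" unfolding E_def using LIMSEQ_le_const2[OF t_lim] by blast
      qed (use t in \<open>auto simp: E_def intro: less_le_trans\<close>)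
      moreover have "(\<lambda>n. emeasure lebesgue {x. t n < u x}) \<longlonglongrightarrow> emeasure lebesgue (\<Inter>n. {x. t n < u x})"
      proof (rule Lim_emeasure_decseq)
        show "decseq (\<lambda>n. {x. t n < u x})"
          using t_incr by (fastforce simp: decseq_def)
        show "emeasure lebesgue {x. t n < u x} \<noteq> \<infinity>" for n
        proof -
          have "emeasure lebesgue {x. t n < u x} \<le> emeasure lebesgue {x. t n \<le> u x}"
            by (intro emeasure_mono lev) auto
          also have "\<dots> \<le> ennreal (J / (t n)\<^sup>2)" by (rule fin[OF t(1)])
          finally show ?thesis by (auto simp: top_unique)
        qed
      qed (use lev in auto)
      ultimately show "(\<lambda>n. emeasure lebesgue {x. t n < u x}) \<longlonglongrightarrow> emeasure lebesgue E" by simp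
      show "\<exists>N. \<forall>n\<ge>N. ennreal \<eta> \<le> emeasure lebesgue {x. t n < u x}"
        using below t by (auto intro!: less_imp_le simp: less_imp_le[OF t(1)])
    qed
    have [measurable]: "(\<lambda>z. u (fst z)) \<in> borel_measurable (lebesgue :: ('a \<times> 'a) measure)"
      "(\<lambda>z. u (snd z)) \<in> borel_measurable (lebesgue :: ('a \<times> 'a) measure)"
      by (auto intro: measurable_compose[OF measurable_fst_lebesgue] measurable_compose[OF measurable_snd_lebesgue]
        simp: u)
    have zero_n: "AE z in lebesgue. M \<le> u (fst z) \<longrightarrow> u (snd z) < t n \<longrightarrow> s z = 0" for n
    proof -
      \<comment> \<open>For levels \<open>t m\<close> beyond \<open>t n\<close>, the function \<open>q\<close> is at most \<open>1 / (M - t m)\<close> times the integrand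
        of the cross term, whose integral is of order \<open>(M - t m)\<^sup>2\<close>.\<close>
      define q where "q z = (if M \<le> u (fst z) then max 0 (t n - u (snd z)) * s z else 0)" for z
      have [measurable]: "q \<in> borel_measurable lebesgue" unfolding q_def by measurable
      define C where "C = A / (1 - \<theta>) * (4 / M\<^sup>2 * J)"
      have q_le: "(\<integral>\<^sup>+z. ennreal (q z) \<partial>lebesgue) \<le> ennreal ((M - t m) * C)" if "n \<le> m" for m
      proof -
        define \<tau> where "\<tau> = M - t m"
        have \<tau>: "\<tau> > 0" using t[of m] by (simp add: \<tau>_def)
        note W' = W[OF less_imp_le[OF t(1)], of m]
        have "(\<integral>\<^sup>+z. ennreal (q z) \<partial>lebesgue)
            \<le> (\<integral>\<^sup>+z. ennreal (v (t m) (fst z) * w (t m) (snd z) * s z / \<tau>) \<partial>lebesgue)"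
        proof (intro nn_integral_mono ennreal_leI)
          fix z
          show "q z \<le> v (t m) (fst z) * w (t m) (snd z) * s z / \<tau>"
          proof (cases "M \<le> u (fst z)")
            case True
            have "\<tau> * max 0 (t n - u (snd z)) \<le> v (t m) (fst z) * w (t m) (snd z)"
              using True \<tau> t_incr[OF that] by (intro mult_mono) (auto simp: v_def w_def \<tau>_def)
            from mult_right_mono[OF this s0[of z]] show ?thesis
              using \<tau> True by (simp add: q_def field_simps)
          next
            case False
            then show ?thesis using s0 \<tau> by (simp add: q_def v_def w_def)
          qed
        qed
        also have "\<dots> = ennreal ((LINT z|lebesgue. v (t m) (fst z) * w (t m) (snd z) * s z) / \<tau>)"
          using W' \<tau> s0 by (subst nn_integral_eq_integral) (auto simp: v_def w_def)
        also have "\<dots> \<le> ennreal (\<tau> * C)"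
        proof (rule ennreal_leI)
          have "0 \<le> (LINT z|lebesgue. (v (t m) (fst z) - v (t m) (snd z))\<^sup>2 * s z)"
            using s0 by (intro Bochner_Integration.integral_nonneg) auto
          with est[OF less_imp_le[OF t(1)], of m]
          have "(1 - \<theta>) * (LINT z|lebesgue. v (t m) (fst z) * w (t m) (snd z) * s z)
              \<le> A * (LINT x|lebesgue. (v (t m) x)\<^sup>2)"
            by simp
          also have "(LINT x|lebesgue. (v (t m) x)\<^sup>2) \<le> (LINT x|lebesgue. \<tau>\<^sup>2 * (4 / M\<^sup>2) * (u x)\<^sup>2)"
          proof (rule integral_mono_AE)
            show "AE x in lebesgue. (v (t m) x)\<^sup>2 \<le> \<tau>\<^sup>2 * (4 / M\<^sup>2) * (u x)\<^sup>2"
              using uM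
            proof eventually_elim
              case (elim x)
              \<comment> \<open>Where \<open>v\<close> is not zero, \<open>u \<ge> M / 2\<close>, and \<open>v \<le> M - t m\<close> everywhere.\<close>
              have "v (t m) x \<le> \<tau> * (2 / M) * \<bar>u x\<bar>"
              proof (cases "t m < u x")
                case True
                then have "1 \<le> 2 / M * \<bar>u x\<bar>" using t_half[of m] M by (simp add: field_simps)
                then have "\<tau> * 1 \<le> \<tau> * (2 / M * \<bar>u x\<bar>)" using \<tau> by (intro mult_left_mono) auto
                moreover have "v (t m) x \<le> \<tau>" using True elim by (simp add: v_def \<tau>_def)
                ultimately show ?thesis by (simp add: mult.assoc)
              qed (use \<tau> M in \<open>simp add: v_def\<close>)
              then have "(v (t m) x)\<^sup>2 \<le> (\<tau> * (2 / M) * \<bar>u x\<bar>)\<^sup>2"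
                by (intro power_mono) (auto simp: v_def)
              then show ?case by (simp add: power_mult_distrib power_divide)
            qed
          qed (use v2[OF less_imp_le[OF t(1)]] u2 in auto)
          also have "\<dots> = \<tau>\<^sup>2 * (4 / M\<^sup>2 * J)" by (simp add: J_def)
          finally have "(1 - \<theta>) * (LINT z|lebesgue. v (t m) (fst z) * w (t m) (snd z) * s z)
              \<le> A * (\<tau>\<^sup>2 * (4 / M\<^sup>2 * J))"
            using A by (simp add: mult_left_mono)
          then have "(LINT z|lebesgue. v (t m) (fst z) * w (t m) (snd z) * s z)
              \<le> A * (\<tau>\<^sup>2 * (4 / M\<^sup>2 * J)) / (1 - \<theta>)"
            using \<theta> by (subst pos_le_divide_eq) (auto simp: mult.commute)
          also have "\<dots> = \<tau>\<^sup>2 * C" by (simp add: C_def mult_ac)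
          finally have "(LINT z|lebesgue. v (t m) (fst z) * w (t m) (snd z) * s z) \<le> \<tau>\<^sup>2 * C" .
          then show "(LINT z|lebesgue. v (t m) (fst z) * w (t m) (snd z) * s z) / \<tau> \<le> \<tau> * C"
            using \<tau> by (simp add: field_simps power2_eq_square)
        qed
        finally show ?thesis by (simp add: \<tau>_def)
      qed
      have "(\<lambda>m. ennreal ((M - t m) * C)) \<longlonglongrightarrow> ennreal ((M - M) * C)"
        by (intro tendsto_intros t_lim)
      then have "(\<integral>\<^sup>+z. ennreal (q z) \<partial>lebesgue) \<le> ennreal ((M - M) * C)"
        by (rule LIMSEQ_le_const) (use q_le in auto)
      then have "(\<integral>\<^sup>+z. ennreal (q z) \<partial>lebesgue) = 0" by simp
      then have "AE z in lebesgue. ennreal (q z) = 0"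
        by (subst (asm) nn_integral_0_iff_AE) auto
      then show ?thesis
      proof eventually_elim
        case (elim z)
        show ?case
        proof (intro impI)
          assume "M \<le> u (fst z)" "u (snd z) < t n"
          with elim have "(t n - u (snd z)) * s z \<le> 0" by (simp add: q_def ennreal_eq_0_iff max_def)
          with \<open>u (snd z) < t n\<close> show "s z = 0" using s0[of z] by (simp add: mult_le_0_iff)
        qed
      qed
    qed
    have zero: "AE z in lebesgue. M \<le> u (fst z) \<longrightarrow> u (snd z) < M \<longrightarrow> s z = 0"
    proof -
      have "AE z in lebesgue. \<forall>n. M \<le> u (fst z) \<longrightarrow> u (snd z) < t n \<longrightarrow> s z = 0"
        unfolding AE_all_countable using zero_n by blast
      then show ?thesis
      proof eventually_elim
        case (elim z)
        show ?case
        proof (intro impI)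
          assume "M \<le> u (fst z)" "u (snd z) < M"
          moreover obtain n where "u (snd z) < t n"
            using order_tendstoD(1)[OF t_lim \<open>u (snd z) < M\<close>] by (auto simp: eventually_sequentially)
          ultimately show "s z = 0" using elim by blast
        qed
      qed
    qed
    define e :: "'a \<Rightarrow> real" where "e = indicator E"
    have e2: "(\<integral>\<^sup>+x. ennreal ((e x)\<^sup>2) \<partial>lebesgue) = emeasure lebesgue E"
    proof -
      have "ennreal ((e x)\<^sup>2) = indicator E x" for x by (simp add: e_def indicator_def)
      then show ?thesis by simp
    qed
    have e: "e \<in> L2"
    proof -
      have "(\<lambda>x. (e x)\<^sup>2) = indicator E" by (auto simp: e_def indicator_def)
      moreover have "emeasure lebesgue E < \<infinity>"
        using E_fin by (auto intro: le_less_trans)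
      ultimately show ?thesis using E by (simp add: L2_def e_def)
    qed
    have "AE z in lebesgue. ennreal ((e (fst z) - e (snd z))\<^sup>2 * s z) = 0"
      using zero AE_swap_lebesgue[OF zero]
      by eventually_elim (auto simp: e_def E_def indicator_def sym not_le)
    then have "(\<integral>\<^sup>+z. ennreal ((e (fst z) - e (snd z))\<^sup>2 * s z) \<partial>lebesgue) = (\<integral>\<^sup>+z. 0 \<partial>(lebesgue :: ('a \<times> 'a) measure))"
      by (rule nn_integral_cong_AE)
    then have no_energy: "(\<integral>\<^sup>+z. ennreal ((e (fst z) - e (snd z))\<^sup>2 * s z) \<partial>lebesgue) = 0" by simp
    \<comment> \<open>A radius so large that \<open>E\<close> fills at most half of a ball. As \<open>\<rho> \<ge> 1\<close>, its power
      is at least \<open>\<rho>\<close>, which avoids taking a root.\<close>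
    define \<rho> where "\<rho> = 1 + 2 * (J / M\<^sup>2) / \<beta>"
    have \<rho>: "\<rho> \<ge> 1" using J0 \<beta> by (simp add: \<rho>_def)
    have "J / M\<^sup>2 \<le> \<beta> * \<rho> / 2" using \<beta> by (simp add: \<rho>_def field_simps)
    also have "\<dots> \<le> \<beta> * \<rho> ^ DIM('a) / 2"
      using \<rho> \<beta> power_increasing[of 1 "DIM('a)" \<rho>] DIM_positive[where 'a='a] by (simp add: Suc_le_eq)
    finally have "emeasure lebesgue {x. e x \<noteq> 0} \<le> ennreal (\<beta> * \<rho> ^ DIM('a) / 2)"
      using order.trans[OF E_fin ennreal_leI] by (simp add: e_def indicator_def)
    from gap[OF e _ this] \<rho> no_energy
    have "ennreal (c * (\<beta> / 2 / \<rho> powr \<alpha>)) * emeasure lebesgue E = 0"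
      by (simp add: e2)
    then have "emeasure lebesgue E = 0"
      using c \<beta> \<rho> by (simp add: ennreal_eq_0_iff divide_le_0_iff mult_le_0_iff)
    with E_pos \<eta> show ?thesis by (simp add: ennreal_eq_0_iff)
  qed
qed

section \<open>Symmetric and antisymmetric part of the kernel\<close>

lemma ksym_commute: "ksym k x y = ksym k y x"
  by (simp add: ksym_def add.commute)

text \<open>
  This form without extended real subtraction shows that the real kernel is measurable: an infinite
  value of \<open>kanti\<close> becomes 0 as a real number, so it joins the case where both values are infinite.
\<close>

lemma real_kanti_eq:
  "real_of_ereal (kanti k x y) =
     (if k x y = \<infinity> \<or> k y x = \<infinity> then 0 else (enn2real (k x y) - enn2real (k y x)) / 2)"
  by (cases "k x y"; cases "k y x") (auto simp: kanti_def)

lemma ksym_finite_cases: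
  assumes "ksym k x y < \<infinity>"
  obtains p q where "0 \<le> p" "0 \<le> q" "ksym k x y = ennreal ((p + q) / 2)" "kanti k x y = ereal ((p - q) / 2)"
proof -
  have "k x y \<noteq> \<infinity>" "k y x \<noteq> \<infinity>"
    using assms by (auto simp: ksym_def ennreal_top_divide)
  then obtain p q where pq: "0 \<le> p" "0 \<le> q" "k x y = ennreal p" "k y x = ennreal q"
    by (metis ennreal_cases infinity_ennreal_def)
  have "ksym k x y = ennreal ((p + q) / 2)"
    using pq divide_ennreal[of "p + q" 2] by (simp add: ksym_def)
  moreover have "kanti k x y = ereal ((p - q) / 2)"
    using pq by (simp add: kanti_def)
  ultimately show ?thesis using that pq by blast
qed

lemma AE_off_diagonal: "AE z in lebesgue. fst z \<noteq> (snd z :: 'a::euclidean_space)"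
proof -
  have "AE z in (lborel :: 'a measure) \<Otimes>\<^sub>M lborel. fst z \<noteq> snd z"
  proof (rule lborel_pair.AE_pair_measure)
    have "closed {z :: 'a \<times> 'a. fst z = snd z}"
      by (intro closed_Collect_eq continuous_intros)
    then have "- {z :: 'a \<times> 'a. fst z = snd z} \<in> sets borel" by auto
    then show "{z \<in> space (lborel \<Otimes>\<^sub>M lborel). fst z \<noteq> (snd z :: 'a)} \<in> sets (lborel \<Otimes>\<^sub>M lborel)"
      unfolding lborel_prod by (simp add: Compl_eq)
    show "AE x in lborel. AE y in lborel. fst (x, y) \<noteq> (snd (x, y) :: 'a)"
    proof (rule AE_I2)
      fix x :: 'a
      show "AE y in lborel. fst (x, y) \<noteq> snd (x, y)"
        using AE_lborel_singleton[of x] by eventually_elim auto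
    qed
  qed
  then show ?thesis unfolding lborel_prod by (rule AE_completion)
qed

text \<open>
  Local integrability of \<open>x \<mapsto> \<integral> (1 \<and> \<bar>x - y\<bar>\<^sup>2) * ksym k x y dy\<close> forces \<open>ksym k\<close> to be finite almost
  everywhere where the weight is positive, that is, off the diagonal, which is itself a null set.
\<close>

lemma AE_ksym_finite:
  fixes k :: "'a::euclidean_space \<Rightarrow> 'a \<Rightarrow> ennreal"
  assumes k: "(\<lambda>z. ksym k (fst z) (snd z)) \<in> borel_measurable lebesgue"
    and loc: "(\<lambda>x. \<integral>\<^sup>+y. ennreal (min 1 ((norm (x - y))\<^sup>2)) * ksym k x y \<partial>lebesgue) \<in> L1_loc"
  shows "AE z in lebesgue. ksym k (fst z) (snd z) < \<infinity>"
proof -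
  define h where "h n z = ennreal (min 1 ((norm (fst z - snd z))\<^sup>2)) * ksym k (fst z) (snd z) * indicator (cball 0 (real n)) (fst z)"
    for n and z :: "'a \<times> 'a"
  have meas: "h n \<in> borel_measurable lebesgue" for n
  proof -
    have 1: "(\<lambda>z. ennreal (min 1 ((norm (fst z - snd z))\<^sup>2))) \<in> borel_measurable (lebesgue :: ('a \<times> 'a) measure)"
      by (intro measurable_completion) (simp add: borel_prod[symmetric])
    have 2: "(\<lambda>z. indicator (cball 0 (real n)) (fst z) :: ennreal) \<in> borel_measurable (lebesgue :: ('a \<times> 'a) measure)"
      by (rule measurable_compose[OF measurable_fst_lebesgue borel_measurable_indicator]) auto
    show ?thesis unfolding h_def by (intro borel_measurable_times_ennreal 1 2 k)
  qed
  have "AE z in lebesgue. h n z \<noteq> \<infinity>" for n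
  proof (rule nn_integral_PInf_AE[OF meas])
    have "(\<integral>\<^sup>+z. h n z \<partial>lebesgue) = (\<integral>\<^sup>+x. \<integral>\<^sup>+y. h n (x, y) \<partial>lebesgue \<partial>lebesgue)"
      by (rule nn_integral_lebesgue_pair[OF meas, symmetric])
    also have "\<dots> = (\<integral>\<^sup>+x\<in>cball 0 (real n). (\<integral>\<^sup>+y. ennreal (min 1 ((norm (x - y))\<^sup>2)) * ksym k x y \<partial>lebesgue) \<partial>lebesgue)"
      by (intro nn_integral_cong) (simp add: h_def indicator_def)
    also have "\<dots> < \<infinity>" using loc by (simp add: L1_loc_def)
    finally show "(\<integral>\<^sup>+z. h n z \<partial>lebesgue) \<noteq> \<infinity>" by simp
  qed
  then have "AE z in lebesgue. \<forall>n. h n z \<noteq> \<infinity>" by (simp add: AE_all_countable)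
  then show ?thesis
    using AE_off_diagonal
  proof eventually_elim
    case (elim z)
    obtain n where "norm (fst z) \<le> real n" using real_arch_simple by blast
    with elim(1)[rule_format, of n] elim(2) show ?case
      by (auto simp: h_def ennreal_mult_eq_top_iff less_top ennreal_eq_0_iff min_def split: if_splits)
  qed
qed


section \<open>The weak maximum principle\<close>

theorem theorem4p1:
  fixes \<Omega> :: "'a::euclidean_space set"
    and k :: "'a \<Rightarrow> 'a \<Rightarrow> ennreal"
    and A :: ennreal and \<alpha> lam D :: real
    and u :: "'a \<Rightarrow> real"
  assumes "open \<Omega>" and "bounded \<Omega>"
    and "(\<lambda>(x, y). k x y) \<in> borel_measurable lebesgue"
    and "(\<lambda>x. \<integral>\<^sup>+y. ennreal (min 1 ((norm (x - y))\<^sup>2)) * ksym k x y \<partial>lebesgue) \<in> L1_loc"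
    and "A < \<infinity>"
    and "esssup lebesgue
           (\<lambda>x. \<integral>\<^sup>+y\<in>{y. ksym k x y \<noteq> 0}. (e2ennreal \<bar>kanti k x y\<bar>)\<^sup>2 / ksym k x y \<partial>lebesgue) \<le> A"
    and "0 < \<alpha>" and "\<alpha> < 2" and "0 < lam"
    and "\<forall>w\<in>L2.
           (\<integral>\<^sup>+x. \<integral>\<^sup>+y. ennreal ((w x - w y)\<^sup>2) * ksym k x y \<partial>lebesgue \<partial>lebesgue) \<ge>
           ennreal (lam * \<alpha> * (2 - \<alpha>)) *
             (\<integral>\<^sup>+x. \<integral>\<^sup>+y. ennreal ((w x - w y)\<^sup>2 / norm (x - y) powr (real DIM('a) + \<alpha>))
                \<partial>lebesgue \<partial>lebesgue)"
    and "D > 1"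
    and "AE (x, y) in lebesgue. e2ennreal \<bar>kanti k x y\<bar> \<le> ennreal (inverse D) * ksym k x y"
    and "u \<in> H_on \<Omega> k"
    and "\<forall>\<phi>\<in>H_on \<Omega> k. energy_form k u \<phi> \<le> 0"
  shows "esssup (lebesgue_on \<Omega>) (\<lambda>x. ereal (u x)) \<le> 0"
proof -
  define s where "s z = enn2real (ksym k (fst z) (snd z))" for z
  define a where "a z = real_of_ereal (kanti k (fst z) (snd z))" for z
  define v where "v l x = max 0 (u x - l)" for l x
  have k1: "(\<lambda>z. k (fst z) (snd z)) \<in> borel_measurable lebesgue"
    using assms(3) by (simp add: case_prod_beta')
  have k2: "(\<lambda>z. k (snd z) (fst z)) \<in> borel_measurable lebesgue"
    using measurable_compose[OF measurable_swap_lebesgue k1] by simp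
  note [measurable] = k1 k2
  have ks: "(\<lambda>z. ksym k (fst z) (snd z)) \<in> borel_measurable lebesgue"
    unfolding ksym_def by measurable
  have s[measurable]: "s \<in> borel_measurable lebesgue"
    unfolding s_def[abs_def] by (intro borel_measurable_enn2real ks)
  have a[measurable]: "a \<in> borel_measurable lebesgue"
    unfolding a_def[abs_def] real_kanti_eq by measurable
  have s0: "0 \<le> s z" for z by (simp add: s_def)
  have sym: "s (prod.swap z) = s z" for z by (simp add: s_def ksym_commute)
  \<comment> \<open>Almost everywhere the kernels are finite, and all hypotheses pass to \<open>s\<close> and \<open>a\<close>.\<close>
  have ks_fin: "AE z in lebesgue. ksym k (fst z) (snd z) < \<infinity>"
    by (rule AE_ksym_finite[OF ks assms(4)])
  have s_eq: "AE z in lebesgue. ksym k (fst z) (snd z) = ennreal (s z)"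
    using ks_fin by eventually_elim (simp add: s_def)
  have ka_eq: "AE z in lebesgue. e2ennreal \<bar>kanti k (fst z) (snd z)\<bar> = ennreal \<bar>a z\<bar>"
    using ks_fin
  proof eventually_elim
    case (elim z)
    then show ?case
      by (rule ksym_finite_cases) (simp add: a_def ennreal.abs_eq[symmetric] e2ennreal_ereal)
  qed
  have u: "u \<in> borel_measurable lebesgue" "integrable lebesgue (\<lambda>x. (u x)\<^sup>2)"
    and u_energy: "(\<integral>\<^sup>+z. ennreal ((u (fst z) - u (snd z))\<^sup>2) * ksym k (fst z) (snd z) \<partial>lebesgue) < \<infinity>"
    and u_out: "AE x in lebesgue. x \<notin> \<Omega> \<longrightarrow> u x = 0"
    using assms(13) by (auto simp: H_on_def H_def L2_def case_prod_beta')
  have diff_meas: "(\<lambda>z. f (fst z) - f (snd z)) \<in> borel_measurable lebesgue"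
    if "f \<in> borel_measurable lebesgue" for f :: "'a \<Rightarrow> real"
    using that by (intro borel_measurable_diff)
      (auto intro: measurable_compose[OF measurable_fst_lebesgue] measurable_compose[OF measurable_snd_lebesgue])
  have v_test: "v l \<in> H_on \<Omega> k" if l: "0 \<le> l" for l
  proof -
    have vm: "v l \<in> borel_measurable lebesgue" using u(1) by (simp add: v_def[abs_def])
    have "integrable lebesgue (\<lambda>x. (v l x)\<^sup>2)"
    proof (rule Bochner_Integration.integrable_bound[OF u(2)])
      show "AE x in lebesgue. norm ((v l x)\<^sup>2) \<le> norm ((u x)\<^sup>2)"
        using l by (auto simp: v_def max_def intro!: power_mono)
    qed (use vm in simp)
    moreover have "(\<integral>\<^sup>+z. ennreal ((v l (fst z) - v l (snd z))\<^sup>2) * ksym k (fst z) (snd z) \<partial>lebesgue)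
      \<le> (\<integral>\<^sup>+z. ennreal ((u (fst z) - u (snd z))\<^sup>2) * ksym k (fst z) (snd z) \<partial>lebesgue)"
      by (intro nn_integral_mono mult_right_mono ennreal_leI)
         (auto simp: v_def max_def simp flip: abs_le_square_iff)
    moreover have "AE x in lebesgue. x \<notin> \<Omega> \<longrightarrow> v l x = 0"
      using u_out by eventually_elim (use l in \<open>auto simp: v_def\<close>)
    ultimately show ?thesis
      using vm u_energy by (auto simp: H_on_def H_def L2_def case_prod_beta' intro: le_less_trans)
  qed
  have fin: "integrable lebesgue (\<lambda>z. (u (fst z) - u (snd z))\<^sup>2 * s z)"
  proof (rule integrableI_nonneg)
    have "(\<integral>\<^sup>+z. ennreal ((u (fst z) - u (snd z))\<^sup>2 * s z) \<partial>lebesgue)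
        = (\<integral>\<^sup>+z. ennreal ((u (fst z) - u (snd z))\<^sup>2) * ksym k (fst z) (snd z) \<partial>lebesgue)"
      using s_eq s0 by (intro nn_integral_cong_AE) (auto elim!: eventually_mono simp: ennreal_mult)
    with u_energy show "(\<integral>\<^sup>+z. ennreal ((u (fst z) - u (snd z))\<^sup>2 * s z) \<partial>lebesgue) < \<infinity>" by simp
  qed (use s0 diff_meas[OF u(1)] in auto)
  have dom: "AE z in lebesgue. \<bar>a z\<bar> \<le> inverse D * s z"
  proof -
    have "AE z in lebesgue. e2ennreal \<bar>kanti k (fst z) (snd z)\<bar> \<le> ennreal (inverse D) * ksym k (fst z) (snd z)"
      using assms(12) by (simp add: case_prod_beta')
    with ka_eq s_eq show ?thesis
    proof eventually_elim
      case (elim z)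
      then have "ennreal \<bar>a z\<bar> \<le> ennreal (inverse D * s z)"
        using assms(11) s0 by (simp add: ennreal_mult)
      then show ?case using assms(11) s0 by (subst (asm) ennreal_le_iff) auto
    qed
  qed
  obtain A' where A': "A = ennreal A'" "0 \<le> A'"
    using assms(5) by (cases A) auto
  have drift: "AE x in lebesgue. (\<integral>\<^sup>+y. ennreal ((a (x, y))\<^sup>2 / s (x, y)) \<partial>lebesgue) \<le> ennreal A'"
  proof -
    have "AE x in lebesgue. (\<integral>\<^sup>+y\<in>{y. ksym k x y \<noteq> 0}. (e2ennreal \<bar>kanti k x y\<bar>)\<^sup>2 / ksym k x y \<partial>lebesgue) \<le> A"
      using esssup_AE by (rule AE_mp) (use assms(6) in \<open>auto intro: order.trans\<close>)
    moreover note AE_lebesgue_pair[OF s_eq] AE_lebesgue_pair[OF ka_eq]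
    ultimately show ?thesis
    proof eventually_elim
      case (elim x)
      have "(\<integral>\<^sup>+y. ennreal ((a (x, y))\<^sup>2 / s (x, y)) \<partial>lebesgue)
          \<le> (\<integral>\<^sup>+y\<in>{y. ksym k x y \<noteq> 0}. (e2ennreal \<bar>kanti k x y\<bar>)\<^sup>2 / ksym k x y \<partial>lebesgue)"
      proof (rule nn_integral_mono_AE)
        show "AE y in lebesgue. ennreal ((a (x, y))\<^sup>2 / s (x, y))
            \<le> (e2ennreal \<bar>kanti k x y\<bar>)\<^sup>2 / ksym k x y * indicator {y. ksym k x y \<noteq> 0} y"
          using elim(2,3)
        proof eventually_elim
          case (elim y)
          show ?case
          proof (cases "s (x, y) = 0")
            case False
            then have "s (x, y) > 0" using s0[of "(x, y)"] by simp
            then show ?thesis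
              using elim by (simp add: indicator_def ennreal_power divide_ennreal)
          qed simp
        qed
      qed
      also have "\<dots> \<le> ennreal A'" using elim(1) A' by simp
      finally show ?case .
    qed
  qed
  have test: "1 / 2 * (LINT z|lebesgue. (u (fst z) - u (snd z)) * (v l (fst z) - v l (snd z)) * s z)
        + (LINT z|lebesgue. (u (fst z) - u (snd z)) * v l (fst z) * a z) \<le> 0" if "0 \<le> l" for l
    using assms(14) v_test[OF that] by (auto simp: energy_form_def case_prod_beta' s_def a_def)
  note est = truncation_energy_estimate[OF u s a s0 sym fin dom A'(2) drift _ test[unfolded v_def]]
  have coer: "ennreal (lam * \<alpha> * (2 - \<alpha>)) *
        (\<integral>\<^sup>+x. \<integral>\<^sup>+y. ennreal ((e x - e y)\<^sup>2 / norm (x - y) powr (real DIM('a) + \<alpha>)) \<partial>lebesgue \<partial>lebesgue)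
        \<le> (\<integral>\<^sup>+z. ennreal ((e (fst z) - e (snd z))\<^sup>2 * s z) \<partial>lebesgue)" if "e \<in> L2" for e
  proof -
    have em: "(\<lambda>z. e (fst z) - e (snd z)) \<in> borel_measurable lebesgue"
      using that by (intro diff_meas) (simp add: L2_def)
    have "(\<integral>\<^sup>+x. \<integral>\<^sup>+y. ennreal ((e x - e y)\<^sup>2) * ksym k x y \<partial>lebesgue \<partial>lebesgue)
        = (\<integral>\<^sup>+z. ennreal ((e (fst z) - e (snd z))\<^sup>2) * ksym k (fst z) (snd z) \<partial>lebesgue)"
      using em ks by (subst nn_integral_lebesgue_pair[symmetric]) auto
    also have "\<dots> = (\<integral>\<^sup>+z. ennreal ((e (fst z) - e (snd z))\<^sup>2 * s z) \<partial>lebesgue)"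
      using s_eq s0 by (intro nn_integral_cong_AE) (auto elim!: eventually_mono simp: ennreal_mult)
    finally show ?thesis using assms(10) that by auto
  qed
  have "AE x in lebesgue. u x \<le> 0"
  proof (rule nonpos_of_truncation_estimates[OF u s s0 sym A'(2) _ _ assms(7) est(1) est(2) est(3) coer])
    show "inverse D < 1" using assms(11) by (simp add: inverse_less_1_iff)
    show "0 < lam * \<alpha> * (2 - \<alpha>)" using assms by simp
  qed
  moreover have \<Omega>: "\<Omega> \<in> sets lebesgue" using assms(1) by simp
  ultimately have "AE x in lebesgue_on \<Omega>. ereal (u x) \<le> 0"
    by (auto simp: AE_restrict_space_iff elim!: eventually_mono)
  then show ?thesis
    using u(1) \<Omega> by (intro esssup_I) (auto intro!: measurable_restrict_space1)
qed

end
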